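(* Let $(\mathbb{N}_0,b,m)$ be a birth-death chain and let $W:\mathbb{N}_0\to\mathbb{R}$ be a potential such that the Schr\"odinger operator $L_c+W$ on $\ell^2(\mathbb{N}_0,m)$ is semi-bounded with lower bound $K\in\mathbb{R}$. If $$\sum_{k=0}^{\infty}\left(\prod_{i=0}^{k}\left[\left(1+\frac{b(i,i+1)+(W(i+1)-\lambda)\,m(i+1)}{b(i+1,i+2)}\right)^2+\left(\frac{b(i,i+1)}{b(i+1,i+2)}\right)^2+1\right]\right)m(k+2)<\infty$$ for some $\lambda<K$, then $L_c+W$ is not essentially self-adjoint.
   Context: $\mathbb{N}_0=\{0,1,2,\dots\}$. A birth-death chain $(\mathbb{N}_0,b,m)$ consists of a symmetric edge-weight $b:\mathbb{N}_0\times\mathbb{N}_0\to[0,\infty)$ with $b(x,y)>0$ if and only if $|x-y|=1$, and a measure $m:\mathbb{N}_0\to(0,\infty)$. All functions are real-valued. $C_c(\mathbb{N}_0)$ is the space of finitely supported functions $\mathbb{N}_0\to\mathbb{R}$, and $\ell^2(\mathbb{N}_0,m)$ is the real Hilbert space of $f:\mathbb{N}_0\to\mathbb{R}$ with $\sum_x f(x)^2m(x)<\infty$, with inner product $\langle f,g\rangle=\sum_x f(x)g(x)m(x)$. The formal Laplacian acts on all functions $f:\mathbb{N}_0\to\mathbb{R}$ by $$\Delta f(x)=\frac{1}{m(x)}\sum_{y\in\mathbb{N}_0}b(x,y)(f(x)-f(y)),$$ and $W$ acts by multiplication, $(Wf)(x)=W(x)f(x)$. The Schr\"odinger operator $L_c+W$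 is the restriction of $\Delta+W$ to the dense domain $C_c(\mathbb{N}_0)\subseteq\ell^2(\mathbb{N}_0,m)$; it is a symmetric operator in $\ell^2(\mathbb{N}_0,m)$. It is semi-bounded with lower bound $K\in\mathbb{R}$ if $\langle(\Delta+W)\varphi,\varphi\rangle\ge K\langle\varphi,\varphi\rangle$ for all $\varphi\in C_c(\mathbb{N}_0)$. A densely defined symmetric operator is essentially self-adjoint if its closure is self-adjoint (equivalently, it has a unique self-adjoint extension). *)

theory Defs
  imports Complex_Main
begin

locale birth_death_chain =
  fixes b :: "nat \<Rightarrow> nat \<Rightarrow> real" and m :: "nat \<Rightarrow> real"
  assumes b_nonneg: "0 \<le> b x y"
    and b_sym: "b x y = b y x"
    and b_pos_iff: "0 < b x y \<longleftrightarrow> \<bar>int x - int y\<bar> = 1"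
    and m_pos: "0 < m x"

definition Cc :: "(nat \<Rightarrow> real) set" where
  "Cc = {f. finite {x. f x \<noteq> 0}}"

definition l2 :: "(nat \<Rightarrow> real) \<Rightarrow> (nat \<Rightarrow> real) set" where
  "l2 m = {f. summable (\<lambda>x. (f x)\<^sup>2 * m x)}"

definition l2_inner :: "(nat \<Rightarrow> real) \<Rightarrow> (nat \<Rightarrow> real) \<Rightarrow> (nat \<Rightarrow> real) \<Rightarrow> real" where
  "l2_inner m f g = (\<Sum>x. f x * g x * m x)"

definition l2_norm :: "(nat \<Rightarrow> real) \<Rightarrow> (nat \<Rightarrow> real) \<Rightarrow> real" where
  "l2_norm m f = sqrt (l2_inner m f f)"

(* For a birth-death chain the sum over y has at most two nonzero terms. *)
definition formal_laplacian ::
    "(nat \<Rightarrow> nat \<Rightarrow> real) \<Rightarrow> (nat \<Rightarrow> real) \<Rightarrow> (nat \<Rightarrow> real) \<Rightarrow> nat \<Rightarrow> real" where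
  "formal_laplacian b m f x = 1 / m x * (\<Sum>y. b x y * (f x - f y))"

definition formal_schroedinger ::
    "(nat \<Rightarrow> nat \<Rightarrow> real) \<Rightarrow> (nat \<Rightarrow> real) \<Rightarrow> (nat \<Rightarrow> real) \<Rightarrow> (nat \<Rightarrow> real) \<Rightarrow> nat \<Rightarrow> real" where
  "formal_schroedinger b m W f x = formal_laplacian b m f x + W x * f x"

(* An unbounded operator in l2 m with domain D is represented by its graph {(f, A f) | f. f \<in> D}. *)
type_synonym l2_operator = "((nat \<Rightarrow> real) \<times> (nat \<Rightarrow> real)) set"

definition schroedinger_Cc ::
    "(nat \<Rightarrow> nat \<Rightarrow> real) \<Rightarrow> (nat \<Rightarrow> real) \<Rightarrow> (nat \<Rightarrow> real) \<Rightarrow> l2_operator" where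
  "schroedinger_Cc b m W = {(\<phi>, formal_schroedinger b m W \<phi>) | \<phi>. \<phi> \<in> Cc}"

definition semibounded :: "(nat \<Rightarrow> real) \<Rightarrow> l2_operator \<Rightarrow> real \<Rightarrow> bool" where
  "semibounded m A K \<longleftrightarrow> (\<forall>(f, g)\<in>A. l2_inner m g f \<ge> K * l2_inner m f f)"

definition densely_defined :: "(nat \<Rightarrow> real) \<Rightarrow> l2_operator \<Rightarrow> bool" where
  "densely_defined m A \<longleftrightarrow>
     (\<forall>f\<in>l2 m. \<forall>\<epsilon>>0. \<exists>g\<in>Domain A. l2_norm m (\<lambda>x. f x - g x) < \<epsilon>)"

definition symmetric_operator :: "(nat \<Rightarrow> real) \<Rightarrow> l2_operator \<Rightarrow> bool" where
  "symmetric_operator m A \<longleftrightarrow>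
     (\<forall>(f, f')\<in>A. \<forall>(g, g')\<in>A. l2_inner m f' g = l2_inner m f g')"

(* Closure of the graph in the product of l2 m with itself. *)
definition operator_closure :: "(nat \<Rightarrow> real) \<Rightarrow> l2_operator \<Rightarrow> l2_operator" where
  "operator_closure m A = {(f, g). f \<in> l2 m \<and> g \<in> l2 m \<and>
     (\<exists>u v. (\<forall>n::nat. (u n, v n) \<in> A) \<and>
        (\<lambda>n. l2_norm m (\<lambda>x. u n x - f x)) \<longlonglongrightarrow> 0 \<and>
        (\<lambda>n. l2_norm m (\<lambda>x. v n x - g x)) \<longlonglongrightarrow> 0)}"

definition adjoint_operator :: "(nat \<Rightarrow> real) \<Rightarrow> l2_operator \<Rightarrow> l2_operator" where
  "adjoint_operator m A = {(g, h). g \<in> l2 m \<and> h \<in> l2 m \<and>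
     (\<forall>(f, f')\<in>A. l2_inner m f' g = l2_inner m f h)}"

definition self_adjoint_operator :: "(nat \<Rightarrow> real) \<Rightarrow> l2_operator \<Rightarrow> bool" where
  "self_adjoint_operator m A \<longleftrightarrow> adjoint_operator m A = A"

(* Meant for densely defined symmetric operators only; the lemmas below
   show that schroedinger_Cc is one. *)
definition essentially_self_adjoint :: "(nat \<Rightarrow> real) \<Rightarrow> l2_operator \<Rightarrow> bool" where
  "essentially_self_adjoint m A \<longleftrightarrow> self_adjoint_operator m (operator_closure m A)"

lemma Cc_subset_l2: "Cc \<subseteq> l2 m"
proof
  fix f assume "f \<in> Cc"
  then have "finite {x. f x \<noteq> 0}" by (simp add: Cc_def)
  then have "summable (\<lambda>x. (f x)\<^sup>2 * m x)"
    by (rule summable_finite) auto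
  then show "f \<in> l2 m" by (simp add: l2_def)
qed

context birth_death_chain
begin

lemma b_eq_0: "b x y = 0" if "y \<notin> {x - 1, x + 1}"
proof -
  have "\<bar>int x - int y\<bar> \<noteq> 1" using that by auto
  then show ?thesis using b_pos_iff[of x y] b_nonneg[of x y] by linarith
qed

lemma formal_laplacian_finite_sum:
  assumes "finite S" "{x - 1, x + 1} \<subseteq> S"
  shows "formal_laplacian b m f x = 1 / m x * (\<Sum>y\<in>S. b x y * (f x - f y))"
proof -
  have "(\<Sum>y. b x y * (f x - f y)) = (\<Sum>y\<in>S. b x y * (f x - f y))"
  proof (rule suminf_finite[OF assms(1)])
    fix y assume "y \<notin> S"
    then have "y \<notin> {x - 1, x + 1}" using assms(2) by blast
    then show "b x y * (f x - f y) = 0" by (simp add: b_eq_0)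
  qed
  then show ?thesis by (simp add: formal_laplacian_def)
qed

lemma formal_schroedinger_eq_0:
  assumes "\<And>x. x \<ge> N \<Longrightarrow> f x = 0" "x \<ge> Suc N"
  shows "formal_schroedinger b m W f x = 0"
proof -
  have "(\<Sum>y\<in>{x - 1, x + 1}. b x y * (f x - f y)) = 0"
    by (rule sum.neutral) (use assms in auto)
  then show ?thesis
    using formal_laplacian_finite_sum[of "{x - 1, x + 1}" x f] assms
    by (simp add: formal_schroedinger_def)
qed

lemma Cc_bound: "\<exists>N. \<forall>x\<ge>N. f x = 0" if "f \<in> Cc"
proof -
  have "finite {x. f x \<noteq> 0}" using that by (simp add: Cc_def)
  then obtain N where "\<forall>x\<in>{x. f x \<noteq> 0}. x < N"
    using finite_nat_set_iff_bounded by blast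
  then have "\<forall>x\<ge>N. f x = 0" by (meson mem_Collect_eq not_less)
  then show ?thesis ..
qed

lemma CcI: "f \<in> Cc" if "\<And>x. x \<ge> N \<Longrightarrow> f x = 0"
proof -
  have "{x. f x \<noteq> 0} \<subseteq> {..<N}" using that by (auto simp: not_le[symmetric])
  then show ?thesis by (simp add: Cc_def finite_subset)
qed

lemma formal_schroedinger_Cc: "formal_schroedinger b m W f \<in> Cc" if "f \<in> Cc"
proof -
  obtain N where "\<forall>x\<ge>N. f x = 0" using Cc_bound[OF \<open>f \<in> Cc\<close>] by blast
  then show ?thesis using formal_schroedinger_eq_0[of N f] by (intro CcI[of "Suc N"]) auto
qed

lemma schroedinger_Cc_subset: "schroedinger_Cc b m W \<subseteq> l2 m \<times> l2 m"
  using formal_schroedinger_Cc Cc_subset_l2 by (auto simp: schroedinger_Cc_def)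

lemma schroedinger_Cc_symmetric: "symmetric_operator m (schroedinger_Cc b m W)"
proof -
  have "l2_inner m (formal_schroedinger b m W f) g = l2_inner m f (formal_schroedinger b m W g)"
    if f: "f \<in> Cc" and g: "g \<in> Cc" for f g
  proof -
    obtain N1 N2 where "\<forall>x\<ge>N1. f x = 0" "\<forall>x\<ge>N2. g x = 0"
      using Cc_bound[OF f] Cc_bound[OF g] by blast
    then obtain N where N: "\<And>x. x \<ge> N \<Longrightarrow> f x = 0" "\<And>x. x \<ge> N \<Longrightarrow> g x = 0"
      using that[of "max N1 N2"] by simp
    have lap: "formal_laplacian b m h x * m x = (\<Sum>y<N+2. b x y * (h x - h y))"
      if "x < N" for h x
      using formal_laplacian_finite_sum[of "{..<N+2}" x h] m_pos[of x] that by auto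
    have schr: "formal_schroedinger b m W h x * m x =
        (\<Sum>y<N+2. b x y * (h x - h y)) + W x * h x * m x" if "x < N" for h x
      unfolding lap[OF that, symmetric] formal_schroedinger_def by (simp only: distrib_right)
    have "l2_inner m (formal_schroedinger b m W f) g =
        (\<Sum>x<N. formal_schroedinger b m W f x * g x * m x)"
      unfolding l2_inner_def by (rule suminf_finite) (use N in auto)
    also have "\<dots> = (\<Sum>x<N. (\<Sum>y<N+2. b x y * (f x - f y)) * g x + W x * f x * g x * m x)"
    proof (rule sum.cong)
      fix x assume "x \<in> {..<N}"
      then have "x < N" by simp
      have "formal_schroedinger b m W f x * g x * m x = (formal_schroedinger b m W f x * m x) * g x"
        by (simp only: mult_ac)
      also have "\<dots> = (\<Sum>y<N+2. b x y * (f x - f y)) * g x + W x * f x * g x * m x"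
        unfolding schr[OF \<open>x < N\<close>] by (simp only: distrib_left distrib_right mult_ac)
      finally show "formal_schroedinger b m W f x * g x * m x = (\<Sum>y<N+2. b x y * (f x - f y)) * g x + W x * f x * g x * m x" .
    qed simp
    also have "\<dots> = (\<Sum>x<N. \<Sum>y<N+2. b x y * (f x * g x)) - (\<Sum>x<N. \<Sum>y<N+2. b x y * (f y * g x))
        + (\<Sum>x<N. W x * f x * g x * m x)"
      by (simp only: sum.distrib sum_subtractf sum_distrib_right right_diff_distrib left_diff_distrib mult.assoc)
    also have "(\<Sum>x<N. \<Sum>y<N+2. b x y * (f y * g x)) = (\<Sum>x<N. \<Sum>y<N+2. b x y * (f x * g y))"
    proof -
      have restrict: "(\<Sum>x<N. \<Sum>y<N+2. b x y * (u y * v x)) = (\<Sum>x<N. \<Sum>y<N. b x y * (u y * v x))"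
        if "\<And>x. x \<ge> N \<Longrightarrow> u x = 0" for u v :: "nat \<Rightarrow> real"
        by (intro sum.cong refl sum.mono_neutral_right) (use that in auto)
      have "(\<Sum>x<N. \<Sum>y<N. b x y * (f y * g x)) = (\<Sum>y<N. \<Sum>x<N. b x y * (f y * g x))"
        by (rule sum.swap)
      also have "\<dots> = (\<Sum>x<N. \<Sum>y<N. b x y * (g y * f x))"
        by (intro sum.cong refl) (simp add: b_sym[of x y for x y] mult.commute[of "f _"])
      finally show ?thesis
        using restrict[of f g] restrict[of g f] N by (simp add: mult.commute)
    qed
    also have "(\<Sum>x<N. \<Sum>y<N+2. b x y * (f x * g x)) - (\<Sum>x<N. \<Sum>y<N+2. b x y * (f x * g y))
        + (\<Sum>x<N. W x * f x * g x * m x) =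
        (\<Sum>x<N. f x * (\<Sum>y<N+2. b x y * (g x - g y)) + W x * f x * g x * m x)"
      by (simp only: sum.distrib sum_subtractf sum_distrib_left right_diff_distrib left_diff_distrib mult.left_commute)
    also have "\<dots> = (\<Sum>x<N. f x * formal_schroedinger b m W g x * m x)"
    proof (rule sum.cong)
      fix x assume "x \<in> {..<N}"
      then have "x < N" by simp
      have "f x * formal_schroedinger b m W g x * m x = (formal_schroedinger b m W g x * m x) * f x"
        by (simp only: mult_ac)
      also have "\<dots> = f x * (\<Sum>y<N+2. b x y * (g x - g y)) + W x * f x * g x * m x"
        unfolding schr[OF \<open>x < N\<close>] by (simp only: distrib_left distrib_right mult_ac)
      finally show "f x * (\<Sum>y<N+2. b x y * (g x - g y)) + W x * f x * g x * m x = f x * formal_schroedinger b m W g x * m x" by (rule sym)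
    qed simp
    also have "\<dots> = l2_inner m f (formal_schroedinger b m W g)"
      unfolding l2_inner_def by (rule suminf_finite[symmetric]) (use N in auto)
    finally show ?thesis .
  qed
  then show ?thesis by (auto simp: symmetric_operator_def schroedinger_Cc_def)
qed

lemma schroedinger_Cc_densely_defined: "densely_defined m (schroedinger_Cc b m W)"
  unfolding densely_defined_def
proof (intro ballI allI impI)
  fix f and \<epsilon> :: real assume f: "f \<in> l2 m" and "\<epsilon> > 0"
  let ?t = "\<lambda>x. (f x)\<^sup>2 * m x"
  have s: "summable ?t" using f by (simp add: l2_def)
  obtain N where N: "norm (\<Sum>i. ?t (i + N)) < \<epsilon>\<^sup>2"
    using suminf_exist_split[OF _ s, of "\<epsilon>\<^sup>2"] \<open>\<epsilon> > 0\<close> by (metis order_refl zero_less_power)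
  define g where "g = (\<lambda>x. if x < N then f x else 0)"
  let ?d = "\<lambda>x. (f x - g x) * (f x - g x) * m x"
  have "g \<in> Cc" by (rule CcI[of N]) (simp add: g_def)
  then have "g \<in> Domain (schroedinger_Cc b m W)" by (auto simp: schroedinger_Cc_def)
  moreover have "l2_norm m (\<lambda>x. f x - g x) < \<epsilon>"
  proof -
    have shift: "(\<lambda>i. ?d (i + N)) = (\<lambda>i. ?t (i + N))" by (auto simp: g_def power2_eq_square)
    then have "summable ?d" using s summable_iff_shift[of ?d N] summable_iff_shift[of ?t N] by simp
    then have "suminf ?d = (\<Sum>i. ?d (i + N)) + (\<Sum>i<N. ?d i)"
      by (rule suminf_split_initial_segment)
    also have "(\<Sum>i<N. ?d i) = 0" by (rule sum.neutral) (auto simp: g_def)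
    finally have "suminf ?d < \<epsilon>\<^sup>2" using N shift by simp
    then show ?thesis
      using \<open>\<epsilon> > 0\<close> by (simp add: l2_norm_def l2_inner_def real_less_lsqrt)
  qed
  ultimately show "\<exists>g\<in>Domain (schroedinger_Cc b m W). l2_norm m (\<lambda>x. f x - g x) < \<epsilon>" by blast
qed

end

end

theory Submission
  imports Defs
begin

text \<open>
  The proof exhibits a deficiency vector. Let \<open>l < K\<close> be as in the hypothesis. On a birth-death chain
  the equation \<open>(\<Delta> + W) u = l u\<close> is a three-term recurrence, so it has a solution with \<open>u 0 = 1\<close>.
  Each new value is a combination of the two previous ones, and the Cauchy-Schwarz inequality in the
  plane bounds \<open>(u (k+2))\<^sup>2 + (u (k+1))\<^sup>2\<close> by the \<open>k\<close>-th factor of the product in the hypothesis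
  times \<open>(u (k+1))\<^sup>2 + (u k)\<^sup>2\<close>. Hence \<open>(u (k+2))\<^sup>2\<close> is at most a constant times that product, and
  the summability condition says precisely that this majorant is summable against \<open>m\<close>; so \<open>u\<close> lies
  in the Hilbert space (\<open>eigen_solution_l2\<close>).

  Green's formula (\<open>formal_schroedinger_green\<close>) shows that \<open>u\<close> is an eigenvector, for the eigenvalue
  \<open>l\<close>, of the adjoint of the operator on finitely supported functions, and that adjoint does not
  change on passing to the closure (\<open>adjoint_subset_adjoint_closure\<close>). If the closure were
  self-adjoint, \<open>u\<close> would thus be an eigenvector of the closure. But the closure inherits the lower
  bound \<open>K\<close> (\<open>semibounded_closure\<close>), so all its eigenvalues are at least \<open>K\<close>, contradicting
  \<open>l < K\<close>.
\<close>

section \<open>Continuity of the weighted inner product\<close>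

context
  fixes m :: "nat \<Rightarrow> real"
  assumes m_nonneg: "\<And>x. 0 \<le> m x"
begin

lemma l2_mult_summable:
  assumes "f \<in> l2 m" "g \<in> l2 m"
  shows "summable (\<lambda>x. f x * g x * m x)"
proof (rule summable_comparison_test)
  show "summable (\<lambda>x. (f x)\<^sup>2 * m x + (g x)\<^sup>2 * m x)"
    using assms by (intro summable_add) (simp_all add: l2_def)
  have "norm (f x * g x * m x) \<le> (f x)\<^sup>2 * m x + (g x)\<^sup>2 * m x" for x
  proof -
    have "0 \<le> (\<bar>f x\<bar> - \<bar>g x\<bar>)\<^sup>2" "0 \<le> (f x)\<^sup>2" "0 \<le> (g x)\<^sup>2" by simp_all
    then have "\<bar>f x\<bar> * \<bar>g x\<bar> \<le> (f x)\<^sup>2 + (g x)\<^sup>2"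
      unfolding power2_diff power2_abs by linarith
    then have "\<bar>f x\<bar> * \<bar>g x\<bar> * m x \<le> ((f x)\<^sup>2 + (g x)\<^sup>2) * m x"
      by (rule mult_right_mono) (rule m_nonneg)
    then show ?thesis by (simp add: abs_mult m_nonneg distrib_right)
  qed
  then show "\<exists>N. \<forall>n\<ge>N. norm (f n * g n * m n) \<le> (f n)\<^sup>2 * m n + (g n)\<^sup>2 * m n"
    by blast
qed

lemma l2_add_scaled:
  assumes "f \<in> l2 m" "g \<in> l2 m"
  shows "(\<lambda>x. f x + c * g x) \<in> l2 m"
proof -
  have "summable (\<lambda>x. (f x)\<^sup>2 * m x + (2 * c) * (f x * g x * m x) + c\<^sup>2 * ((g x)\<^sup>2 * m x))"
    using assms l2_mult_summable[OF assms]
    by (intro summable_add summable_mult) (simp_all add: l2_def)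
  also have "(\<lambda>x. (f x)\<^sup>2 * m x + (2 * c) * (f x * g x * m x) + c\<^sup>2 * ((g x)\<^sup>2 * m x))
      = (\<lambda>x. (f x + c * g x)\<^sup>2 * m x)"
    by (auto simp: power2_eq_square algebra_simps)
  finally show ?thesis by (simp add: l2_def)
qed

lemma l2_diff: "f \<in> l2 m \<Longrightarrow> g \<in> l2 m \<Longrightarrow> (\<lambda>x. f x - g x) \<in> l2 m"
  using l2_add_scaled[of f g "-1"] by simp

lemma l2_inner_commute: "l2_inner m f g = l2_inner m g f"
  by (simp add: l2_inner_def mult.commute[of "f _"])

lemma l2_inner_add_scaled_left:
  assumes "f \<in> l2 m" "g \<in> l2 m" "h \<in> l2 m"
  shows "l2_inner m (\<lambda>x. f x + c * g x) h = l2_inner m f h + c * l2_inner m g h"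
proof -
  have "l2_inner m f h + c * l2_inner m g h = (\<Sum>x. f x * h x * m x + c * (g x * h x * m x))"
    unfolding l2_inner_def
    using suminf_add[OF l2_mult_summable[OF assms(1,3)] summable_mult[OF l2_mult_summable[OF assms(2,3)], of c]]
      suminf_mult[OF l2_mult_summable[OF assms(2,3)], of c]
    by simp
  then show ?thesis by (simp add: l2_inner_def algebra_simps)
qed

lemma l2_inner_self_nonneg:
  assumes "f \<in> l2 m"
  shows "0 \<le> l2_inner m f f"
  unfolding l2_inner_def
  by (rule suminf_nonneg[OF l2_mult_summable[OF assms assms]]) (simp add: m_nonneg)

text \<open>The quadratic polynomial \<open>t \<mapsto> \<parallel>f + t g\<parallel>\<^sup>2\<close> is nonnegative, so its discriminant is not positive.\<close>

lemma l2_Cauchy_Schwarz: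
  assumes f: "f \<in> l2 m" and g: "g \<in> l2 m"
  shows "\<bar>l2_inner m f g\<bar> \<le> l2_norm m f * l2_norm m g"
proof -
  define A B C where "A = l2_inner m f f" and "B = l2_inner m g g" and "C = l2_inner m f g"
  have B: "0 \<le> B" using l2_inner_self_nonneg[OF g] by (simp add: B_def)
  have quad: "0 \<le> A + 2 * t * C + t\<^sup>2 * B" for t
  proof -
    let ?h = "\<lambda>x. f x + t * g x"
    have h: "?h \<in> l2 m" by (rule l2_add_scaled[OF f g])
    have "l2_inner m ?h ?h = l2_inner m ?h f + t * l2_inner m ?h g"
      using l2_inner_add_scaled_left[OF f g h, of t]
      l2_inner_commute[of f ?h] l2_inner_commute[of g ?h] by simp
    also have "\<dots> = A + 2 * t * C + t\<^sup>2 * B"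
      unfolding l2_inner_add_scaled_left[OF f g f] l2_inner_add_scaled_left[OF f g g]
        l2_inner_commute[of g f]
      by (simp add: A_def B_def C_def power2_eq_square algebra_simps)
    finally show ?thesis using l2_inner_self_nonneg[OF h] by simp
  qed
  have "C\<^sup>2 \<le> A * B"
  proof (cases "B = 0")
    case True
    have "C = 0"
    proof (rule ccontr)
      assume "C \<noteq> 0"
      \<comment> \<open>Without quadratic term the polynomial is affine; at this \<open>t\<close> it takes the value \<open>-1\<close>.\<close>
      then show False using quad[of "- (A + 1) / (2 * C)"] True by (simp add: field_simps)
    qed
    then show ?thesis using True by simp
  next
    case False
    \<comment> \<open>The minimum of the polynomial, attained at \<open>t = - C / B\<close>.\<close>
    then have "0 \<le> (A * B - C\<^sup>2) / B"
      using quad[of "- C / B"] by (simp add: field_simps power2_eq_square)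
    then show ?thesis using False B by (simp add: zero_le_divide_iff)
  qed
  then have "sqrt (C\<^sup>2) \<le> sqrt (A * B)" by (rule real_sqrt_le_mono)
  then show ?thesis
    by (simp add: A_def B_def C_def l2_norm_def real_sqrt_mult)
qed

lemma l2_inner_tendsto:
  assumes fn: "\<And>n::nat. u n \<in> l2 m" and f: "f \<in> l2 m"
    and gn: "\<And>n. v n \<in> l2 m" and g: "g \<in> l2 m"
    and uf: "(\<lambda>n. l2_norm m (\<lambda>x. u n x - f x)) \<longlonglongrightarrow> 0"
    and vg: "(\<lambda>n. l2_norm m (\<lambda>x. v n x - g x)) \<longlonglongrightarrow> 0"
  shows "(\<lambda>n. l2_inner m (u n) (v n)) \<longlonglongrightarrow> l2_inner m f g"
proof -
  let ?p = "\<lambda>n x. u n x - f x" and ?q = "\<lambda>n x. v n x - g x"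
  have p: "?p n \<in> l2 m" and q: "?q n \<in> l2 m" for n
    using fn gn f g by (auto intro: l2_diff)
  have left: "l2_inner m (u n) h = l2_inner m f h + l2_inner m (?p n) h" if "h \<in> l2 m" for n h
    using l2_inner_add_scaled_left[OF f p[of n] that, of 1] by simp
  have right: "l2_inner m h (v n) = l2_inner m h g + l2_inner m h (?q n)" if "h \<in> l2 m" for n h
    using l2_inner_add_scaled_left[OF g q[of n] that, of 1]
      l2_inner_commute[of h "v n"] l2_inner_commute[of h g] l2_inner_commute[of h "?q n"] by simp
  have expand: "l2_inner m (u n) (v n) =
      l2_inner m f g + l2_inner m f (?q n) + l2_inner m (?p n) g + l2_inner m (?p n) (?q n)" for n
    using left[OF gn[of n]] right[OF f, of n] right[OF p, of n n] by simp
  have null: "w \<longlonglongrightarrow> 0" if "z \<longlonglongrightarrow> 0" "\<And>n. \<bar>w n\<bar> \<le> z n" for w z :: "nat \<Rightarrow> real"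
    using tendsto_0_le[OF that(1), of w 1] order_trans[OF that(2) abs_ge_self] by simp
  have fq: "(\<lambda>n. l2_inner m f (?q n)) \<longlonglongrightarrow> 0"
    by (rule null[OF tendsto_mult_right_zero[OF vg] l2_Cauchy_Schwarz[OF f q]])
  have pg: "(\<lambda>n. l2_inner m (?p n) g) \<longlonglongrightarrow> 0"
    by (rule null[OF tendsto_mult_left_zero[OF uf] l2_Cauchy_Schwarz[OF p g]])
  have pq: "(\<lambda>n. l2_inner m (?p n) (?q n)) \<longlonglongrightarrow> 0"
    by (rule null[OF tendsto_mult_zero[OF uf vg] l2_Cauchy_Schwarz[OF p q]])
  have "(\<lambda>n. l2_inner m f g + l2_inner m f (?q n) + l2_inner m (?p n) g + l2_inner m (?p n) (?q n))
      \<longlonglongrightarrow> l2_inner m f g + 0 + 0 + 0"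
    by (intro tendsto_add tendsto_const fq pg pq)
  then show ?thesis by (simp add: expand)
qed

section \<open>Passing to the closure of an operator\<close>

text \<open>
  Together with the converse inclusion, which is trivial because the closure is the larger operator,
  this says that an operator and its closure have the same adjoint.
\<close>

lemma adjoint_subset_adjoint_closure:
  assumes A: "A \<subseteq> l2 m \<times> l2 m"
  shows "adjoint_operator m A \<subseteq> adjoint_operator m (operator_closure m A)"
proof clarify
  fix g h assume gh: "(g, h) \<in> adjoint_operator m A"
  then have g: "g \<in> l2 m" and h: "h \<in> l2 m"
    and adj: "\<And>f f'. (f, f') \<in> A \<Longrightarrow> l2_inner m f' g = l2_inner m f h"
    by (auto simp: adjoint_operator_def)
  have const: "(\<lambda>n. l2_norm m (\<lambda>x. k x - k x)) \<longlonglongrightarrow> 0" for k :: "nat \<Rightarrow> real"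
    by (simp add: l2_norm_def l2_inner_def)
  have "l2_inner m f' g = l2_inner m f h" if ff': "(f, f') \<in> operator_closure m A" for f f'
  proof -
    obtain u v where f: "f \<in> l2 m" and f': "f' \<in> l2 m" and uv: "\<And>n::nat. (u n, v n) \<in> A"
      and u: "(\<lambda>n. l2_norm m (\<lambda>x. u n x - f x)) \<longlonglongrightarrow> 0"
      and v: "(\<lambda>n. l2_norm m (\<lambda>x. v n x - f' x)) \<longlonglongrightarrow> 0"
      using ff' by (auto simp: operator_closure_def)
    have un: "u n \<in> l2 m" and vn: "v n \<in> l2 m" for n using uv[of n] A by auto
    have "(\<lambda>n. l2_inner m (v n) g) \<longlonglongrightarrow> l2_inner m f' g"
      by (rule l2_inner_tendsto[OF vn f' g g v const])
    moreover have "(\<lambda>n. l2_inner m (u n) h) \<longlonglongrightarrow> l2_inner m f h"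
      by (rule l2_inner_tendsto[OF un f h h u const])
    ultimately show ?thesis using adj[OF uv] LIMSEQ_unique by simp
  qed
  then show "(g, h) \<in> adjoint_operator m (operator_closure m A)"
    using g h by (auto simp: adjoint_operator_def)
qed

lemma semibounded_closure:
  assumes A: "A \<subseteq> l2 m \<times> l2 m" and K: "semibounded m A K"
  shows "semibounded m (operator_closure m A) K"
proof -
  have "K * l2_inner m f f \<le> l2_inner m f' f" if ff': "(f, f') \<in> operator_closure m A" for f f'
  proof -
    obtain u v where f: "f \<in> l2 m" and f': "f' \<in> l2 m" and uv: "\<And>n::nat. (u n, v n) \<in> A"
      and u: "(\<lambda>n. l2_norm m (\<lambda>x. u n x - f x)) \<longlonglongrightarrow> 0"
      and v: "(\<lambda>n. l2_norm m (\<lambda>x. v n x - f' x)) \<longlonglongrightarrow> 0"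
      using ff' by (auto simp: operator_closure_def)
    have un: "u n \<in> l2 m" and vn: "v n \<in> l2 m" for n using uv[of n] A by auto
    have "(\<lambda>n. K * l2_inner m (u n) (u n)) \<longlonglongrightarrow> K * l2_inner m f f"
      by (intro tendsto_mult_left l2_inner_tendsto[OF un f un f u u])
    moreover have "(\<lambda>n. l2_inner m (v n) (u n)) \<longlonglongrightarrow> l2_inner m f' f"
      by (rule l2_inner_tendsto[OF vn f' un f v u])
    moreover have "K * l2_inner m (u n) (u n) \<le> l2_inner m (v n) (u n)" for n
      using K uv[of n] by (auto simp: semibounded_def)
    ultimately show ?thesis by (auto intro: LIMSEQ_le)
  qed
  then show ?thesis by (auto simp: semibounded_def)
qed

end

text \<open>
  An eigenvalue of the adjoint below the lower bound would, if the closure were self-adjoint, be an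
  eigenvalue of the closure, on which the same lower bound holds.
\<close>

lemma not_essentially_self_adjoint_if_adjoint_eigenvector:
  assumes m_pos: "\<And>x. 0 < m x" and A: "A \<subseteq> l2 m \<times> l2 m" and K: "semibounded m A K"
    and eigen: "(u, \<lambda>x. l * u x) \<in> adjoint_operator m A" and l: "l < K" and nz: "u x\<^sub>0 \<noteq> 0"
  shows "\<not> essentially_self_adjoint m A"
proof
  assume "essentially_self_adjoint m A"
  then have sa: "adjoint_operator m (operator_closure m A) = operator_closure m A"
    by (simp add: essentially_self_adjoint_def self_adjoint_operator_def)
  have m0: "\<And>x. 0 \<le> m x" using m_pos less_imp_le by blast
  have "(u, \<lambda>x. l * u x) \<in> operator_closure m A"
    using adjoint_subset_adjoint_closure[OF m0 A] eigen sa by blast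
  then have le: "K * l2_inner m u u \<le> l2_inner m (\<lambda>x. l * u x) u"
    using semibounded_closure[OF m0 A K] by (auto simp: semibounded_def)
  have u: "u \<in> l2 m" using eigen by (simp add: adjoint_operator_def)
  have s: "summable (\<lambda>x. u x * u x * m x)" by (rule l2_mult_summable[OF m0 u u])
  have "l2_inner m (\<lambda>x. l * u x) u = l * l2_inner m u u"
    using suminf_mult[OF s, of l] by (simp add: l2_inner_def mult.assoc)
  moreover have "0 < l2_inner m u u"
    unfolding l2_inner_def
  proof (rule suminf_pos2[OF s])
    show "0 \<le> u n * u n * m n" for n by (simp add: m0)
    show "0 < u x\<^sub>0 * u x\<^sub>0 * m x\<^sub>0" using nz m_pos[of x\<^sub>0] by (auto simp: zero_less_mult_iff)
  qed
  ultimately show False using le l by simp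
qed

section \<open>The formal Laplacian on a birth-death chain\<close>

context birth_death_chain
begin

lemma formal_laplacian_0: "formal_laplacian b m f 0 = b 0 1 * (f 0 - f 1) / m 0"
  using formal_laplacian_finite_sum[of "{0, 1}" 0 f] by simp

lemma formal_laplacian_Suc:
  "formal_laplacian b m f (Suc k) =
     (b k (Suc k) * (f (Suc k) - f k) + b (Suc k) (Suc (Suc k)) * (f (Suc k) - f (Suc (Suc k)))) / m (Suc k)"
  using formal_laplacian_finite_sum[of "{k, Suc (Suc k)}" "Suc k" f] b_sym[of k "Suc k"] by simp

lemma formal_schroedinger_cong:
  assumes "\<And>y. y \<le> Suc x \<Longrightarrow> f y = g y"
  shows "formal_schroedinger b m W f x = formal_schroedinger b m W g x"
proof -
  have "(\<Sum>y\<le>Suc x. b x y * (f x - f y)) = (\<Sum>y\<le>Suc x. b x y * (g x - g y))"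
    using assms by (intro sum.cong) auto
  then show ?thesis
    using formal_laplacian_finite_sum[of "{..Suc x}" x] assms[of x]
    by (simp add: formal_schroedinger_def)
qed

text \<open>
  Only finitely many values of \<open>u\<close> enter, so \<open>u\<close> may be cut off beyond the neighbours of the support
  of \<open>\<phi>\<close>; for two finitely supported functions the formula is the symmetry of the operator.
\<close>

lemma formal_schroedinger_green:
  assumes "\<phi> \<in> Cc"
  shows "l2_inner m (formal_schroedinger b m W \<phi>) u = l2_inner m \<phi> (formal_schroedinger b m W u)"
proof -
  let ?H = "formal_schroedinger b m W"
  obtain N where N: "\<And>x. x \<ge> N \<Longrightarrow> \<phi> x = 0" using Cc_bound[OF assms] by blast
  define v where "v = (\<lambda>x. if x \<le> N then u x else 0)"
  have v: "v \<in> Cc" by (rule CcI[of "Suc N"]) (simp add: v_def)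
  have 1: "?H \<phi> x * u x * m x = ?H \<phi> x * v x * m x" for x
    using formal_schroedinger_eq_0[where N = N and f = \<phi> and x = x and W = W, OF N] by (cases "x \<le> N") (auto simp: v_def)
  have 2: "\<phi> x * ?H v x * m x = \<phi> x * ?H u x * m x" for x
  proof (cases "x < N")
    case True
    have "?H v x = ?H u x"
      by (rule formal_schroedinger_cong) (use True in \<open>simp add: v_def\<close>)
    then show ?thesis by simp
  qed (simp add: N)
  have "l2_inner m (?H \<phi>) v = l2_inner m \<phi> (?H v)"
    using schroedinger_Cc_symmetric[of W] assms v
    by (auto simp: symmetric_operator_def schroedinger_Cc_def)
  then show ?thesis by (simp add: l2_inner_def 1 2)
qed

lemma eigenfunction_in_adjoint:
  assumes u: "u \<in> l2 m" and eq: "\<And>x. formal_schroedinger b m W u x = l * u x"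
  shows "(u, \<lambda>x. l * u x) \<in> adjoint_operator m (schroedinger_Cc b m W)"
proof -
  have "(\<lambda>x. l * u x) \<in> l2 m"
    using u summable_mult[of "\<lambda>x. (u x)\<^sup>2 * m x" "l\<^sup>2"]
    by (simp add: l2_def power_mult_distrib mult.assoc)
  moreover have "formal_schroedinger b m W u = (\<lambda>x. l * u x)" using eq by blast
  ultimately show ?thesis
    using u formal_schroedinger_green[of _ W u]
    by (auto simp: adjoint_operator_def schroedinger_Cc_def)
qed

end

section \<open>A square-summable formal eigenfunction\<close>

definition step_coeff ::
    "(nat \<Rightarrow> nat \<Rightarrow> real) \<Rightarrow> (nat \<Rightarrow> real) \<Rightarrow> (nat \<Rightarrow> real) \<Rightarrow> real \<Rightarrow> nat \<Rightarrow> real" where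
  "step_coeff b m W l k = 1 + (b k (k+1) + (W (k+1) - l) * m (k+1)) / b (k+1) (k+2)"

text \<open>
  The equation \<open>(\<Delta> + W) u = l u\<close>, read at the vertex \<open>0\<close> and at the vertices \<open>k + 1\<close>, determines
  \<open>u 1\<close> and \<open>u (k + 2)\<close> from the preceding values.
\<close>

fun eigen_solution ::
    "(nat \<Rightarrow> nat \<Rightarrow> real) \<Rightarrow> (nat \<Rightarrow> real) \<Rightarrow> (nat \<Rightarrow> real) \<Rightarrow> real \<Rightarrow> nat \<Rightarrow> real" where
  "eigen_solution b m W l 0 = 1"
| "eigen_solution b m W l (Suc 0) = 1 + (W 0 - l) * m 0 / b 0 1"
| "eigen_solution b m W l (Suc (Suc k)) =
     step_coeff b m W l k * eigen_solution b m W l (Suc k)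
     - b k (k+1) / b (k+1) (k+2) * eigen_solution b m W l k"

lemma (in birth_death_chain) eigen_solution_eq:
  "formal_schroedinger b m W (eigen_solution b m W l) x = l * eigen_solution b m W l x"
proof (cases x)
  case 0
  have "0 < b 0 1" "0 < m 0" using b_pos_iff[of 0 1] m_pos by simp_all
  then show ?thesis
    using 0 by (simp add: formal_schroedinger_def formal_laplacian_0 field_simps)
next
  case (Suc k)
  have "0 < b (Suc k) (Suc (Suc k))" "0 < m (Suc k)"
    using b_pos_iff[of "Suc k" "Suc (Suc k)"] m_pos by simp_all
  then show ?thesis
    using Suc by (simp add: formal_schroedinger_def formal_laplacian_Suc step_coeff_def field_simps)
qed

text \<open>
  Cauchy-Schwarz for the pairs \<open>(a, -c)\<close> and \<open>(p, q)\<close>; the summand \<open>1\<close> absorbs the value that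
  is carried over to the next step.
\<close>

lemma two_term_step_bound:
  fixes a c p q :: real
  shows "(a * p - c * q)\<^sup>2 + p\<^sup>2 \<le> (a\<^sup>2 + c\<^sup>2 + 1) * (p\<^sup>2 + q\<^sup>2)"
proof -
  have "(a\<^sup>2 + c\<^sup>2 + 1) * (p\<^sup>2 + q\<^sup>2) - ((a * p - c * q)\<^sup>2 + p\<^sup>2) = (a * q + c * p)\<^sup>2 + q\<^sup>2"
    by (simp add: power2_eq_square algebra_simps)
  then show ?thesis by (smt (verit) zero_le_power2)
qed

lemma eigen_solution_growth:
  fixes b m W l
  defines "u \<equiv> eigen_solution b m W l"
  shows "(u (k+2))\<^sup>2 + (u (k+1))\<^sup>2 \<le>
    (\<Prod>i=0..k. (step_coeff b m W l i)\<^sup>2 + (b i (i+1) / b (i+1) (i+2))\<^sup>2 + 1)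
      * ((u 1)\<^sup>2 + (u 0)\<^sup>2)"
proof (induction k)
  case 0
  show ?case
    using two_term_step_bound[of "step_coeff b m W l 0" "u 1" "b 0 1 / b 1 2" "u 0"]
    by (simp add: u_def numeral_2_eq_2)
next
  case (Suc k)
  let ?c = "\<lambda>i. (step_coeff b m W l i)\<^sup>2 + (b i (i+1) / b (i+1) (i+2))\<^sup>2 + 1"
  have "u (Suc k + 2) = step_coeff b m W l (Suc k) * u (k+2)
      - b (Suc k) (Suc k + 1) / b (Suc k + 1) (Suc k + 2) * u (k+1)"
    by (simp add: u_def)
  then have "(u (Suc k + 2))\<^sup>2 + (u (Suc k + 1))\<^sup>2 \<le> ?c (Suc k) * ((u (k+2))\<^sup>2 + (u (k+1))\<^sup>2)"
    using two_term_step_bound[of "step_coeff b m W l (Suc k)" "u (k+2)"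
        "b (Suc k) (Suc k + 1) / b (Suc k + 1) (Suc k + 2)" "u (k+1)"]
    by simp
  also have "\<dots> \<le> ?c (Suc k) * ((\<Prod>i=0..k. ?c i) * ((u 1)\<^sup>2 + (u 0)\<^sup>2))"
    by (rule mult_left_mono[OF Suc.IH]) simp
  also have "\<dots> = (\<Prod>i=0..Suc k. ?c i) * ((u 1)\<^sup>2 + (u 0)\<^sup>2)"
    by (simp only: prod.atLeast0_atMost_Suc mult_ac)
  finally show ?case .
qed

lemma eigen_solution_l2:
  assumes m0: "\<And>x. 0 \<le> m x"
    and sum: "summable (\<lambda>k.
      (\<Prod>i=0..k. (step_coeff b m W l i)\<^sup>2 + (b i (i+1) / b (i+1) (i+2))\<^sup>2 + 1) * m (k+2))"
  shows "eigen_solution b m W l \<in> l2 m"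
proof -
  let ?u = "eigen_solution b m W l"
  let ?P = "\<lambda>k. \<Prod>i=0..k. (step_coeff b m W l i)\<^sup>2 + (b i (i+1) / b (i+1) (i+2))\<^sup>2 + 1"
  let ?C = "(?u 1)\<^sup>2 + (?u 0)\<^sup>2"
  have "summable (\<lambda>k. (?u (k+2))\<^sup>2 * m (k+2))"
  proof (rule summable_comparison_test'[OF summable_mult[OF sum, of ?C], of 0])
    fix k :: nat
    have "(?u (k+2))\<^sup>2 \<le> ?P k * ?C"
      using eigen_solution_growth[of b m W l k] zero_le_power2[of "?u (k+1)"] by linarith
    then have "(?u (k+2))\<^sup>2 * m (k+2) \<le> ?P k * ?C * m (k+2)"
      by (rule mult_right_mono[OF _ m0])
    then have "(?u (k+2))\<^sup>2 * m (k+2) \<le> ?C * (?P k * m (k+2))"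
      by (simp only: mult_ac)
    moreover have "0 \<le> (?u (k+2))\<^sup>2 * m (k+2)" using m0 by simp
    ultimately show "norm ((?u (k+2))\<^sup>2 * m (k+2)) \<le> ?C * (?P k * m (k+2))"
      by (simp only: real_norm_def abs_of_nonneg)
  qed
  then show ?thesis
    using summable_iff_shift[of "\<lambda>x. (?u x)\<^sup>2 * m x" 2] by (simp add: l2_def)
qed

theorem theorem4p1:
  fixes b :: "nat \<Rightarrow> nat \<Rightarrow> real" and m W :: "nat \<Rightarrow> real" and K :: real
  assumes "birth_death_chain b m"
    and "semibounded m (schroedinger_Cc b m W) K"
    and "\<exists>l<K. summable (\<lambda>k.
           (\<Prod>i=0..k. ((1 + (b i (i+1) + (W (i+1) - l) * m (i+1)) / b (i+1) (i+2))\<^sup>2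
                      + (b i (i+1) / b (i+1) (i+2))\<^sup>2 + 1)) * m (k+2))"
  shows "\<not> essentially_self_adjoint m (schroedinger_Cc b m W)"
proof -
  interpret birth_death_chain b m by fact
  obtain l where l: "l < K" and sum: "summable (\<lambda>k.
      (\<Prod>i=0..k. (step_coeff b m W l i)\<^sup>2 + (b i (i+1) / b (i+1) (i+2))\<^sup>2 + 1) * m (k+2))"
    using assms(3) unfolding step_coeff_def by blast
  have "eigen_solution b m W l \<in> l2 m"
    using eigen_solution_l2[OF less_imp_le[OF m_pos] sum] .
  then have "(eigen_solution b m W l, \<lambda>x. l * eigen_solution b m W l x)
      \<in> adjoint_operator m (schroedinger_Cc b m W)"
    by (rule eigenfunction_in_adjoint) (rule eigen_solution_eq)
  then show ?thesis
    by (rule not_essentially_self_adjoint_if_adjoint_eigenvector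
        [OF m_pos schroedinger_Cc_subset assms(2) _ l, where x\<^sub>0 = 0]) simp
qed

end
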